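(* Let $X\subseteq\mathbb{C}$ and let $f,g:X\times X\to\mathbb{C}$ be functions such that $f\perp g$ and $g(x,y)=-g(y,x)$ for all $x,y\in X$. Then, for any pairwise distinct sequence $\{d_n\}_{n\geq 0}$ in $X$, any integer $n\ge 2$ and any $a,x\in X$ such that the denominators below are nonzero (i.e. $f(a,x)\neq 0$ and $g(d_k,d_i)\ne 0$ for $1\le i\neq k\le n$), we have $$\sum_{k=1}^{n}\bigg(\frac{f(a,d_k)}{f(a,x)}\bigg)^{n-1}\prod_{i=1,\, i \neq k}^{n} \frac{g(x,d_i)}{g(d_k,d_i)}=1.$$
   Context: For functions $f,g:X\times X\to\mathbb{C}$, the notation $f\perp g$ means that for all $x,a,b,c\in X$ (Jacobi's identity) $$f(x,a)g(b,c)+f(x,b)g(c,a)+f(x,c)g(a,b)=0.$$ *)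

theory Defs
  imports Complex_Main
begin

text \<open>Functions on \<open>X \<times> X\<close> are rendered as curried total functions on the complex numbers;
  only their values on \<open>X\<close> are constrained.\<close>

definition jacobi_perp ::
  "complex set \<Rightarrow> (complex \<Rightarrow> complex \<Rightarrow> complex) \<Rightarrow> (complex \<Rightarrow> complex \<Rightarrow> complex) \<Rightarrow> bool" where
  "jacobi_perp X f g \<longleftrightarrow>
    (\<forall>x\<in>X. \<forall>a\<in>X. \<forall>b\<in>X. \<forall>c\<in>X. f x a * g b c + f x b * g c a + f x c * g a b = 0)"

end

theory Submission
  imports Defs
begin

text \<open>
  Multiplied by \<open>f a x ^ (n - 1)\<close>, the claim becomes a homogeneous form of Lagrange interpolation:
  with \<open>F u = f a u\<close>, it says that \<open>F x ^ (n - 1)\<close> is recovered from its values at the \<open>n\<close> nodes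
  \<open>d k\<close>. (Where \<open>F\<close> does not vanish, Jacobi's identity turns \<open>g u v / (F u * F v)\<close> into a difference
  \<open>p u - p v\<close>, and the claim into the interpolation of the constant \<open>1\<close> in the variable \<open>p\<close>.)

  This form holds for every \<open>x\<close> in \<open>X\<close>, also at zeros of \<open>F\<close>, and is proved by induction on the set
  of nodes. When a node \<open>m\<close> is added, Jacobi's identity for \<open>d k\<close>, \<open>d m\<close>, \<open>x\<close> splits each old term
  into \<open>F x\<close> times the corresponding term for the old nodes at \<open>x\<close>, minus a factor independent of
  \<open>k\<close> times the corresponding term for the old nodes at \<open>d m\<close>. The induction hypothesis is therefore
  used at two points: at \<open>x\<close> it yields the claim, and at \<open>d m\<close> it yields exactly the quantity that
  cancels the term of the new node.
\<close>

text \<open>Only the function \<open>f a\<close> of one variable enters, and the nodes form a family because distinct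
  indices matter only through the nonvanishing of \<open>g\<close>. The point \<open>x\<close> is universally quantified in the
  induction, since the hypothesis is also needed at the new node.\<close>

lemma jacobi_lagrange_interpolation:
  fixes F :: "'a \<Rightarrow> 'b::field" and g :: "'a \<Rightarrow> 'a \<Rightarrow> 'b" and d :: "'i \<Rightarrow> 'a"
  assumes "finite I" "I \<noteq> {}"
    and jacobi: "\<And>u v w. u \<in> X \<Longrightarrow> v \<in> X \<Longrightarrow> w \<in> X \<Longrightarrow>
                   F u * g v w + F v * g w u + F w * g u v = 0"
    and antisym: "\<And>u v. u \<in> X \<Longrightarrow> v \<in> X \<Longrightarrow> g u v = - g v u"
    and "d ` I \<subseteq> X"
    and "\<And>i k. i \<in> I \<Longrightarrow> k \<in> I \<Longrightarrow> i \<noteq> k \<Longrightarrow> g (d k) (d i) \<noteq> 0"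
    and "x \<in> X"
  shows "(\<Sum>k\<in>I. F (d k) ^ (card I - 1) * (\<Prod>i\<in>I - {k}. g x (d i) / g (d k) (d i)))
           = F x ^ (card I - 1)"
  using assms(1,2,5-7)
proof (induction I arbitrary: x rule: finite_ne_induct)
  case (singleton m)
  then show ?case by simp
next
  case (insert m I)
  define A where "A y k = F (d k) ^ (card I - 1) * (\<Prod>i\<in>I - {k}. g y (d i) / g (d k) (d i))"
    for y k
  define Q where "Q = (\<Prod>i\<in>I. g x (d i) / g (d m) (d i))"
  have X: "d m \<in> X" "x \<in> X" "\<And>k. k \<in> I \<Longrightarrow> d k \<in> X"
    using insert.prems by auto
  have IH: "(\<Sum>k\<in>I. A y k) = F y ^ (card I - 1)" if "y \<in> X" for y
    unfolding A_def using insert.prems that by (intro insert.IH) auto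
  have card_I: "card I = Suc (card I - 1)"
    using insert.hyps by (simp add: card_gt_0_iff)
  have old_term: "F (d k) ^ card I * (\<Prod>i\<in>insert m I - {k}. g x (d i) / g (d k) (d i))
      = F x * A x k - F (d m) * Q * A (d m) k" if k: "k \<in> I" for k
  proof -
    define R where "R = (\<Prod>i\<in>I - {k}. g x (d i) / g (d k) (d i))"
    have "k \<noteq> m" using k insert.hyps by auto
    then have nz: "g (d k) (d m) \<noteq> 0" "g (d m) (d k) \<noteq> 0"
      using insert.prems(2)[of m k] insert.prems(2)[of k m] k by auto
    have anti: "g (d m) x = - g x (d m)" "g (d k) (d m) = - g (d m) (d k)"
      using antisym X k by blast+
    have "F (d k) * g (d m) x + F (d m) * g x (d k) + F x * g (d k) (d m) = 0"
      using jacobi X k by blast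
    then have "F (d k) * g x (d m) = F x * g (d k) (d m) + F (d m) * g x (d k)"
      unfolding anti(1) by (simp add: algebra_simps add_eq_0_iff)
    then have split: "F (d k) * (g x (d m) / g (d k) (d m))
        = F x - F (d m) * (g x (d k) / g (d m) (d k))"
      using nz unfolding anti(2) by (simp add: field_simps)
    have "Q = (g x (d k) / g (d m) (d k)) * (\<Prod>i\<in>I - {k}. g x (d i) / g (d m) (d i))"
      unfolding Q_def using k insert.hyps by (simp add: prod.remove)
    moreover have "(\<Prod>i\<in>I - {k}. g x (d i) / g (d m) (d i)) * (\<Prod>i\<in>I - {k}. g (d m) (d i) / g (d k) (d i))
        = R"
      unfolding R_def prod.distrib[symmetric]
    proof (rule prod.cong)
      fix i assume "i \<in> I - {k}"
      then have "g (d m) (d i) \<noteq> 0"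
        using insert.prems(2)[of i m] insert.hyps by auto
      then show "g x (d i) / g (d m) (d i) * (g (d m) (d i) / g (d k) (d i)) = g x (d i) / g (d k) (d i)"
        by simp
    qed simp
    ultimately have QA: "Q * A (d m) k = F (d k) ^ (card I - 1) * (g x (d k) / g (d m) (d k)) * R"
      unfolding A_def by (simp add: mult_ac)
    have "insert m I - {k} = insert m (I - {k})"
      using \<open>k \<noteq> m\<close> by auto
    then have "(\<Prod>i\<in>insert m I - {k}. g x (d i) / g (d k) (d i)) = (g x (d m) / g (d k) (d m)) * R"
      unfolding R_def using insert.hyps by simp
    moreover have "F (d k) ^ card I = F (d k) ^ (card I - 1) * F (d k)"
      by (subst card_I) simp
    ultimately have "F (d k) ^ card I * (\<Prod>i\<in>insert m I - {k}. g x (d i) / g (d k) (d i))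
        = F (d k) ^ (card I - 1) * (F (d k) * (g x (d m) / g (d k) (d m))) * R"
      by (simp only: mult_ac)
    also have "\<dots> = F x * A x k - F (d m) * (Q * A (d m) k)"
      unfolding split QA unfolding A_def R_def[symmetric] by (simp add: algebra_simps)
    finally show ?thesis by (simp add: mult.assoc)
  qed
  have "insert m I - {m} = I"
    using insert.hyps by auto
  then have "(\<Sum>k\<in>insert m I. F (d k) ^ card I * (\<Prod>i\<in>insert m I - {k}. g x (d i) / g (d k) (d i)))
      = F (d m) ^ card I * Q + (\<Sum>k\<in>I. F x * A x k - F (d m) * Q * A (d m) k)"
    using insert.hyps by (simp add: Q_def old_term)
  also have "\<dots> = F (d m) ^ card I * Q + (F x * F x ^ (card I - 1)
      - F (d m) * Q * F (d m) ^ (card I - 1))"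
    using IH X by (simp add: sum_subtractf sum_distrib_left[symmetric])
  also have "\<dots> = F x ^ card I"
    by (subst (1 4) card_I) (simp add: algebra_simps)
  finally show ?case
    using insert.hyps by simp
qed

theorem theorem1p2:
  fixes X :: "complex set"
    and f g :: "complex \<Rightarrow> complex \<Rightarrow> complex"
    and d :: "nat \<Rightarrow> complex"
    and n :: nat
    and a x :: complex
  assumes perp: "jacobi_perp X f g"
    and antisym: "\<And>u v. u \<in> X \<Longrightarrow> v \<in> X \<Longrightarrow> g u v = - g v u"
    and d_in: "\<And>m. d m \<in> X"
    and d_distinct: "inj d"
    and n_ge: "n \<ge> 2"
    and a_in: "a \<in> X"
    and x_in: "x \<in> X"
    and f_nz: "f a x \<noteq> 0"
    and g_nz: "\<And>i k. i \<in> {1..n} \<Longrightarrow> k \<in> {1..n} \<Longrightarrow> i \<noteq> k \<Longrightarrow> g (d k) (d i) \<noteq> 0"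
  shows "(\<Sum>k=1..n. (f a (d k) / f a x) ^ (n - 1) *
            (\<Prod>i\<in>{1..n} - {k}. g x (d i) / g (d k) (d i))) = 1"
proof -
  have "(\<Sum>k\<in>{1..n}. f a (d k) ^ (card {1..n} - 1) *
            (\<Prod>i\<in>{1..n} - {k}. g x (d i) / g (d k) (d i))) = f a x ^ (card {1..n} - 1)"
  proof (rule jacobi_lagrange_interpolation[where X = X])
    show "f a u * g v w + f a v * g w u + f a w * g u v = 0"
      if "u \<in> X" "v \<in> X" "w \<in> X" for u v w
      using perp a_in that unfolding jacobi_perp_def by blast
    show "g u v = - g v u" if "u \<in> X" "v \<in> X" for u v
      using antisym that by blast
  qed (use d_in n_ge x_in g_nz in auto)
  then show ?thesis
    using f_nz by (simp add: power_divide sum_divide_distrib[symmetric])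
qed

end
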